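(* Assume Axiom 2 (stated in the context). Then the resultant force acting on the particle is proportional to its acceleration, i.e. there is a constant $\beta>0$ such that for any $n\leqslant N$: $$\boldsymbol{F}(n)=\beta\,\mathbf{a}(n).$$
   Context: $\mathbb{N}$ includes $0$; $\mathbb{N}_7=\{0,1,\dots,6\}$; $\Omega=(\mathbb{N}_7)^{\mathbb{N}}$, with elements $\omega=(\omega_0,\omega_1,\dots)$. For each $n\in\mathbb{N}$, fixed non-negative numbers $p_n(i)$, $i\in\mathbb{N}_7$, satisfy $\sum_{i=0}^6 p_n(i)=1$. $\mathcal{F}$ is the $\sigma$-algebra on $\Omega$ generated by the sets $C(n,i)=\{\omega\in\Omega:\omega_n=i\}$, and $P$ is the probability measure on $\mathcal{F}$ satisfying $P\big(C(0,i_0)\cap C(1,i_1)\cap\dots\cap C(n,i_n)\big)=\prod_{k=0}^n p_k(i_k)$ for all $n\in\mathbb{N}$ and $i_0,\dots,i_n\in\mathbb{N}_7$, and $P(C(n,i))=p_n(i)$. Parameters: $\tau>0$ (unit of time), $c>0$, $\varepsilon=c\tau$, all fixed. With $\mathbf{e}_1,\mathbf{e}_2,\mathbf{e}_3$ the standard basis of $\mathbb{R}^3$, set $\mathbf{s}(0)=(0,0,0)$, and $\mathbf{s}(i)=\varepsilon\mathbf{e}_i$, $\mathbf{s}(i+3)=-\varepsilon\mathbf{e}_i$ for $i=1,2,3$. $\mathbf{S}_n(\omega)=\mathbf{s}(\omega_n)$ for $n\in\mathbb{N}$. The velocity of the particle at time $n\tau$ is $\mathbf{v}(n)=E(\mathbf{S}_n)/\tau$,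 and its acceleration at time $n\tau$ is $\mathbf{a}(n)=\dfrac{\mathbf{v}(n+1)-\mathbf{v}(n)}{\tau}$. Axiom 2. Fix $N\in\mathbb{N}$. Let $\boldsymbol{F}(n)=(F_1(n),F_2(n),F_3(n))$ be the resultant force acting on the particle at time $n\tau$, where each $F_i(n)$ is a difference of two forces: $F_i(n)=f_n(i)-f_n(i+3)$, with real numbers $f_n(j)$, $j=1,\dots,6$ ($f_n(i)$ acts in the direction of $\mathbf{e}_i$ and $f_n(i+3)$ in the opposite direction, $i=1,2,3$). It is assumed that there is a constant $\gamma>0$ such that for any $j=1,2,3,4,5,6$ and $n\leqslant N$: $p_{n+1}(j)-p_n(j)=\gamma f_n(j)$. *)

theory Defs
  imports "HOL-Probability.Probability"
begin

definition N7 :: "nat set" where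
  "N7 = {0..6}"

definition paths :: "(nat \<Rightarrow> nat) set" where
  "paths = (UNIV \<rightarrow> N7)"

definition cyl :: "nat \<Rightarrow> nat \<Rightarrow> (nat \<Rightarrow> nat) set" where
  "cyl n i = {\<omega> \<in> paths. \<omega> n = i}"

text \<open>
  The probability space of the particle: \<open>p n i\<close> is the probability that the \<open>n\<close>-th coordinate
  equals \<open>i\<close>, the coordinates being independent. By Kolmogorov's extension theorem the assumptions
  on the measure \<open>P\<close> determine it uniquely from \<open>p\<close>.
\<close>

locale particle = prob_space P
  for P :: "(nat \<Rightarrow> nat) measure" +
  fixes p :: "nat \<Rightarrow> nat \<Rightarrow> real"
  assumes p_nonneg: "i \<in> N7 \<Longrightarrow> 0 \<le> p n i"
    and p_sum: "(\<Sum>i\<in>N7. p n i) = 1"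
    and space_P: "space P = paths"
    and sets_P: "sets P = sigma_sets paths {cyl n i | n i. i \<in> N7}"
    and prob_cyls: "(\<And>k. k \<le> n \<Longrightarrow> j k \<in> N7) \<Longrightarrow>
          prob (\<Inter>k\<le>n. cyl k (j k)) = (\<Prod>k\<le>n. p k (j k))"
    and prob_cyl: "i \<in> N7 \<Longrightarrow> prob (cyl n i) = p n i"

text \<open>
  The argument \<open>\<epsilon>\<close> is the unit of length. The value outside \<open>N7\<close> is irrelevant; the type \<open>3\<close> has
  the elements \<open>1\<close>, \<open>2\<close> and \<open>3\<close> (the last one being equal to \<open>0\<close>).
\<close>

definition step :: "real \<Rightarrow> nat \<Rightarrow> real ^ 3" where
  "step \<epsilon> i =
    (if i = 1 then \<epsilon> *\<^sub>R axis 1 1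
     else if i = 2 then \<epsilon> *\<^sub>R axis 2 1
     else if i = 3 then \<epsilon> *\<^sub>R axis 3 1
     else if i = 4 then - (\<epsilon> *\<^sub>R axis 1 1)
     else if i = 5 then - (\<epsilon> *\<^sub>R axis 2 1)
     else if i = 6 then - (\<epsilon> *\<^sub>R axis 3 1)
     else 0)"

definition displacement :: "real \<Rightarrow> real \<Rightarrow> nat \<Rightarrow> (nat \<Rightarrow> nat) \<Rightarrow> real ^ 3" where
  "displacement \<tau> c n \<omega> = step (c * \<tau>) (\<omega> n)"

definition velocity :: "(nat \<Rightarrow> nat) measure \<Rightarrow> real \<Rightarrow> real \<Rightarrow> nat \<Rightarrow> real ^ 3" where
  "velocity P \<tau> c n = (\<integral>\<omega>. displacement \<tau> c n \<omega> \<partial>P) /\<^sub>R \<tau>"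

definition acceleration :: "(nat \<Rightarrow> nat) measure \<Rightarrow> real \<Rightarrow> real \<Rightarrow> nat \<Rightarrow> real ^ 3" where
  "acceleration P \<tau> c n = (velocity P \<tau> c (n + 1) - velocity P \<tau> c n) /\<^sub>R \<tau>"

text \<open>
  For \<open>i = 1, 2, 3\<close>, \<open>f n i\<close> is the force at time \<open>n * \<tau>\<close> in the direction of the \<open>i\<close>-th basis
  vector and \<open>f n (i + 3)\<close> the one in the opposite direction.
\<close>

definition resultant_force :: "(nat \<Rightarrow> nat \<Rightarrow> real) \<Rightarrow> nat \<Rightarrow> real ^ 3" where
  "resultant_force f n = vector [f n 1 - f n 4, f n 2 - f n 5, f n 3 - f n 6]"

definition axiom2 ::
  "(nat \<Rightarrow> nat \<Rightarrow> real) \<Rightarrow> (nat \<Rightarrow> nat \<Rightarrow> real) \<Rightarrow> nat \<Rightarrow> bool" where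
  "axiom2 p f N \<longleftrightarrow>
    (\<exists>\<gamma>>0. \<forall>j\<in>{1..6}. \<forall>n\<le>N. p (n + 1) j - p n j = \<gamma> * f n j)"

end

theory Submission
  imports Defs
begin

text \<open>
  Opposite steps cancel in the mean displacement, so the \<open>i\<close>-th component of the velocity is
  \<open>c * (p n i - p n (i + 3))\<close>: each step has length \<open>c * \<tau>\<close> and takes time \<open>\<tau>\<close>
  (\<open>velocity_eq\<close>). The acceleration therefore measures, per unit of time, how this difference of
  probabilities changes from \<open>n\<close> to \<open>n + 1\<close>. By Axiom 2 each of the two probabilities changes
  in proportion to the force in its direction, so their difference changes by \<open>\<gamma>\<close> times the
  component of the resultant force. This gives \<open>a = (c * \<gamma> / \<tau>) F\<close>, and the constant is
  \<open>\<beta> = \<tau> / (c * \<gamma>)\<close>.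
\<close>

context particle
begin

lemma cyl_in_sets: "i \<in> N7 \<Longrightarrow> cyl n i \<in> sets P"
  unfolding sets_P by (intro sigma_sets.Basic) blast

text \<open>
  The \<open>n\<close>-th coordinate is a simple function: the cylinders \<open>cyl n i\<close> partition the space, and any
  function of the coordinate is a combination of their indicators.
\<close>

lemma expectation_coordinate:
  fixes g :: "nat \<Rightarrow> 'b::{banach, second_countable_topology}"
  shows "(\<integral>\<omega>. g (\<omega> n) \<partial>P) = (\<Sum>i\<in>N7. p n i *\<^sub>R g i)"
proof -
  have "(\<integral>\<omega>. g (\<omega> n) \<partial>P) = (\<integral>\<omega>. (\<Sum>i\<in>N7. indicator (cyl n i) \<omega> *\<^sub>R g i) \<partial>P)"
  proof (rule Bochner_Integration.integral_cong[OF refl])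
    fix \<omega> assume "\<omega> \<in> space P"
    then have \<omega>: "\<omega> \<in> paths" and "\<omega> n \<in> N7"
      by (auto simp: space_P paths_def)
    have "(\<Sum>i\<in>N7. indicator (cyl n i) \<omega> *\<^sub>R g i) = (\<Sum>i\<in>N7. if \<omega> n = i then g i else 0)"
      using \<omega> by (intro sum.cong) (auto simp: cyl_def indicator_def)
    also have "\<dots> = g (\<omega> n)"
      using \<open>\<omega> n \<in> N7\<close> by (simp add: N7_def)
    finally show "g (\<omega> n) = (\<Sum>i\<in>N7. indicator (cyl n i) \<omega> *\<^sub>R g i)" ..
  qed
  also have "\<dots> = (\<Sum>i\<in>N7. \<integral>\<omega>. indicator (cyl n i) \<omega> *\<^sub>R g i \<partial>P)"
    by (intro Bochner_Integration.integral_sum integrable_scaleR_left integrable_real_indicator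
        cyl_in_sets) (auto simp: less_top[symmetric])
  also have "\<dots> = (\<Sum>i\<in>N7. p n i *\<^sub>R g i)"
    by (intro sum.cong refl)
      (simp add: cyl_in_sets prob_cyl sets.sets_into_space Int_absorb1 integrable_real_indicator
        less_top[symmetric])
  finally show ?thesis .
qed

lemma velocity_eq:
  assumes "\<tau> \<noteq> 0"
  shows "velocity P \<tau> c n = c *\<^sub>R vector [p n 1 - p n 4, p n 2 - p n 5, p n 3 - p n 6]"
proof -
  have N7: "N7 = {0, 1, 2, 3, 4, 5, 6}"
    by (auto simp: N7_def)
  show ?thesis
    unfolding velocity_def displacement_def expectation_coordinate
    using assms
    by (simp add: N7 vec_eq_iff forall_3 vector_3 step_def axis_def field_simps)
qed

end

theorem theorem5p2:
  fixes P :: "(nat \<Rightarrow> nat) measure" and p f :: "nat \<Rightarrow> nat \<Rightarrow> real"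
    and \<tau> c :: real and N :: nat
  assumes "particle P p" and "\<tau> > 0" and "c > 0"
    and "axiom2 p f N"
  shows "\<exists>\<beta>>0. \<forall>n\<le>N. resultant_force f n = \<beta> *\<^sub>R acceleration P \<tau> c n"
proof -
  obtain \<gamma> where "\<gamma> > 0"
    and force: "\<And>j n. j \<in> {1..6} \<Longrightarrow> n \<le> N \<Longrightarrow> p (n + 1) j - p n j = \<gamma> * f n j"
    using assms(4) unfolding axiom2_def by blast
  have acc: "acceleration P \<tau> c n = (c * \<gamma> / \<tau>) *\<^sub>R resultant_force f n" if "n \<le> N" for n
  proof -
    have diff: "p (n + 1) i - p (n + 1) j - (p n i - p n j) = \<gamma> * (f n i - f n j)"
      if "i \<in> {1..6}" "j \<in> {1..6}" for i j
      using force[OF that(1) \<open>n \<le> N\<close>] force[OF that(2) \<open>n \<le> N\<close>] by (simp add: algebra_simps)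
    have "velocity P \<tau> c (n + 1) - velocity P \<tau> c n = (c * \<gamma>) *\<^sub>R resultant_force f n"
      using \<open>\<tau> > 0\<close> diff[of 1 4] diff[of 2 5] diff[of 3 6]
      by (simp add: particle.velocity_eq[OF assms(1)] resultant_force_def vec_eq_iff forall_3
          vector_3 flip: right_diff_distrib)
    then show ?thesis
      by (simp add: acceleration_def divide_inverse mult.commute)
  qed
  show ?thesis
  proof (intro exI conjI allI impI)
    show "\<tau> / (c * \<gamma>) > 0"
      using assms(2,3) \<open>\<gamma> > 0\<close> by simp
    show "resultant_force f n = (\<tau> / (c * \<gamma>)) *\<^sub>R acceleration P \<tau> c n" if "n \<le> N" for n
      using assms(2,3) \<open>\<gamma> > 0\<close> by (simp add: acc[OF that])
  qed
qed

end
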